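(* Let $A \subset \mathbb{R}$ be finite and nonempty. Then there exist $X, Y \subset A$ such that (i) $X \cup Y = A$, (ii) $|X|, |Y| \geq |A|/2$, and (iii) $d^+(X)\, d^{\times}(Y) \lesssim |A|$.
   Context: For finite $A,B\subset\mathbb{R}$ and $x\in\mathbb{R}$, let $r_{A-B}(x) = \#\{(a,b)\in A\times B : x = a-b\}$ and $r_{A/B}(x) = \#\{(a,b)\in A\times B : a = xb\}$. Define $E_3^+(A,B)=\sum_x r_{A-B}(x)^3$ and $E_3^{\times}(A,B)=\sum_x r_{A/B}(x)^3$. For finite nonempty $A$, define $d^+(A) = \sup_{B} \frac{E_3^+(A,B)}{|A||B|^2}$ and $d^{\times}(A) = \sup_{B} \frac{E_3^{\times}(A,B)}{|A||B|^2}$, the suprema over all finite nonempty $B\subset\mathbb{R}$. The notation $a \lesssim b$ means $a = O(b \log^c |A|)$ for some absolute constant $c>0$.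
   Formalization: The set A = {0} is excluded, since there X = Y = {0} and d^×({0}) is infinite, so (iii) fails; and log|A| is read as log max(2,|A|), since for |A| = 1 the literal bound would be 0 while the left side is at least 1. *)

theory Defs
  imports "HOL-Analysis.Analysis"
begin

definition rep_diff :: "real set \<Rightarrow> real set \<Rightarrow> real \<Rightarrow> nat" where
  "rep_diff A B x = card {(a, b). a \<in> A \<and> b \<in> B \<and> x = a - b}"

definition rep_ratio :: "real set \<Rightarrow> real set \<Rightarrow> real \<Rightarrow> nat" where
  "rep_ratio A B x = card {(a, b). a \<in> A \<and> b \<in> B \<and> a = x * b}"

text \<open>
  The energies are sums over all real numbers and take values in the extended nonnegative reals,
  where every such sum exists. This matters for the multiplicative energy: if \<open>0\<close> lies in both
  sets, the pair \<open>(0, 0)\<close> is counted for every \<open>x\<close> and the energy is \<open>\<infinity>\<close>. In all other cases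
  both sums have finitely many nonzero terms (for finite \<open>A\<close> and \<open>B\<close>).
\<close>

definition energy3_add :: "real set \<Rightarrow> real set \<Rightarrow> ennreal" where
  "energy3_add A B = (\<Sum>\<^sub>\<infinity>x\<in>UNIV. of_nat (rep_diff A B x) ^ 3)"

definition energy3_mult :: "real set \<Rightarrow> real set \<Rightarrow> ennreal" where
  "energy3_mult A B = (\<Sum>\<^sub>\<infinity>x\<in>UNIV. of_nat (rep_ratio A B x) ^ 3)"

definition d_add :: "real set \<Rightarrow> ennreal" where
  "d_add A = (SUP B\<in>{B. finite B \<and> B \<noteq> {}}.
     energy3_add A B / (of_nat (card A) * of_nat (card B) ^ 2))"

text \<open>
  If \<open>0 \<in> A\<close> then \<open>d_mult A = \<infinity>\<close>, since \<open>rep_ratio A B 0 \<ge> card B\<close> for every finite \<open>B\<close>.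
\<close>

definition d_mult :: "real set \<Rightarrow> ennreal" where
  "d_mult A = (SUP B\<in>{B. finite B \<and> B \<noteq> {}}.
     energy3_mult A B / (of_nat (card A) * of_nat (card B) ^ 2))"

text \<open>
  The right-hand side of \<open>a \<lesssim> b\<close> with explicit absolute constants \<open>C\<close> and \<open>c\<close>, for an ambient
  set of size \<open>n\<close>. The maximum only affects \<open>n = 1\<close>, where \<open>ln n\<close> vanishes and the literal
  bound would be \<open>0\<close>.
\<close>

definition log_bound :: "real \<Rightarrow> real \<Rightarrow> nat \<Rightarrow> real \<Rightarrow> real" where
  "log_bound C c n b = C * b * ln (real (max 2 n)) powr c"

end

theory Submission
  imports Defs
begin

text \<open>
  Let \<open>Y\<close> be finite with \<open>0 \<notin> Y\<close>, and let \<open>B\<close> be nearly extremal for \<open>d_mult Y\<close>. A pigeonhole argument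
  gives a set \<open>S\<close> of ratios with at least \<open>k\<close> representations each, such that \<open>k\<^sup>3 |S|\<close> is comparable
  to the energy; a second one gives \<open>X \<subseteq> Y\<close> whose elements all have at least \<open>t\<close> representations
  \<open>x = q p\<close> with \<open>q \<in> S\<close> and \<open>p \<in> B\<close>, where \<open>t |X|\<close> is at least about \<open>k |S|\<close>. Szemeredi-Trotter
  turns the richness of these products into an upper bound for \<open>d_add X\<close>, and the two bounds combine
  to \<open>d_add X d_mult Y \<lesssim> |X|\<^sup>2 / |Y|\<close>. Repeating this on \<open>Y - X\<close> until half of \<open>A\<close> is exhausted, and
  joining the extracted sets by convexity of the cube, proves the theorem. Only incidences between
  lines and Cartesian products are needed, for which Szemeredi-Trotter follows by cutting the
  product into equal cells.
\<close>

section \<open>Szemeredi-Trotter for Cartesian products\<close>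

text \<open>The block index of a point is its rank in \<open>P\<close> divided by \<open>w\<close>.
  Ranks are distinct, so at most \<open>w\<close> of them share a quotient.\<close>

lemma ex_monotone_blocks:
  fixes P :: "real set"
  assumes "finite P" "w \<ge> 1" "card P \<le> w * k"
  obtains f :: "real \<Rightarrow> nat" where "mono_on P f" "\<And>p. p \<in> P \<Longrightarrow> f p < k"
    "\<And>p. p \<in> P \<Longrightarrow> card {p'\<in>P. f p' = f p} \<le> w"
proof
  let ?rank = "\<lambda>p. card {z\<in>P. z < p}"
  let ?f = "\<lambda>p. ?rank p div w"
  have strict: "?rank p < ?rank q" if "p \<in> P" "p < q" for p q
    using that assms(1) by (intro psubset_card_mono) auto
  show "mono_on P ?f"
    using assms(1) by (intro mono_onI div_le_mono card_mono) auto
  fix p assume p: "p \<in> P"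
  have "?rank p < card P"
    using p assms(1) by (intro psubset_card_mono) auto
  then show "?f p < k"
    using assms(3) by (simp add: less_mult_imp_div_less mult.commute)
  have "inj_on ?rank {p'\<in>P. ?f p' = ?f p}"
  proof (rule inj_onI)
    fix x y assume "x \<in> {p'\<in>P. ?f p' = ?f p}" "y \<in> {p'\<in>P. ?f p' = ?f p}" "?rank x = ?rank y"
    then show "x = y" using strict[of x y] strict[of y x] by (cases x y rule: linorder_cases) auto
  qed
  moreover have "?rank ` {p'\<in>P. ?f p' = ?f p} \<subseteq> {?f p * w ..< ?f p * w + w}"
  proof (clarify, simp only: atLeastLessThan_iff, intro conjI)
    fix x assume "?f x = ?f p"
    then show "?f p * w \<le> ?rank x" "?rank x < ?f p * w + w"
      using div_times_less_eq_dividend[of "?rank x" w] dividend_less_div_times[of w "?rank x"] assms(2)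
      by auto
  qed
  ultimately show "card {p'\<in>P. ?f p' = ?f p} \<le> w"
    using card_inj_on_le[of ?rank "{p'\<in>P. ?f p' = ?f p}" "{?f p * w ..< ?f p * w + w}"] by simp
qed

lemma card_eq_pairs_le:
  assumes "finite P" "\<And>p. p \<in> P \<Longrightarrow> card {p'\<in>P. f p' = f p} \<le> w"
  shows "card {(p, p'). p \<in> P \<and> p' \<in> P \<and> f p = f p'} \<le> card P * w"
proof -
  have "{(p, p'). p \<in> P \<and> p' \<in> P \<and> f p = f p'} = (SIGMA p:P. {p'\<in>P. f p' = f p})" by auto
  then have "card {(p, p'). p \<in> P \<and> p' \<in> P \<and> f p = f p'} = (\<Sum>p\<in>P. card {p'\<in>P. f p' = f p})"
    using assms(1) by simp
  also have "\<dots> \<le> card P * w" using sum_bounded_above[of P "\<lambda>p. card {p'\<in>P. f p' = f p}" w] assms(2) by simp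
  finally show ?thesis .
qed

text \<open>At most \<open>m\<close> elements are alone with their colour; each of the others is the
  first entry of a monochromatic pair.\<close>

lemma card_le_colours_plus_pairs:
  fixes h :: "'a \<Rightarrow> nat"
  assumes fin: "finite I" and "\<And>p. p \<in> I \<Longrightarrow> h p < m"
  shows "card I \<le> m + card {(p, p'). p \<in> I \<and> p' \<in> I \<and> p \<noteq> p' \<and> h p = h p'}"
proof -
  define J where "J = {p \<in> I. \<exists>p'\<in>I. p' \<noteq> p \<and> h p' = h p}"
  have "inj_on h (I - J)" by (auto simp: inj_on_def J_def)
  then have "card (I - J) \<le> m"
    using card_inj_on_le[of h "I - J" "{..<m}"] assms by auto
  moreover have "card J \<le> card {(p, p'). p \<in> I \<and> p' \<in> I \<and> p \<noteq> p' \<and> h p = h p'}"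
  proof (rule surj_card_le)
    show "finite {(p, p'). p \<in> I \<and> p' \<in> I \<and> p \<noteq> p' \<and> h p = h p'}"
      by (rule finite_subset[of _ "I \<times> I"]) (use fin in auto)
    show "J \<subseteq> fst ` {(p, p'). p \<in> I \<and> p' \<in> I \<and> p \<noteq> p' \<and> h p = h p'}"
      by (force simp: J_def image_iff)
  qed
  moreover have "card I = card J + card (I - J)"
    using fin by (metis (no_types, lifting) J_def card_Diff_subset card_mono finite_subset le_add_diff_inverse mem_Collect_eq subsetI)
  ultimately show ?thesis by simp
qed

text \<open>A line \<open>y = q * x - b\<close> meets only about \<open>2 * k\<close> of the \<open>k * k\<close> cells, because along it both
  block indices are monotone; two of its points lying in a common cell determine the line.\<close>

lemma grid_incidences_le:
  fixes P S :: "real set" and L :: "(real \<times> real) set"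
  assumes fin: "finite P" "finite S" "finite L"
    and w: "w \<ge> 1" "card P \<le> w * k" and v: "v \<ge> 1" "card S \<le> v * k"
  shows "card {(l, p). l \<in> L \<and> p \<in> P \<and> fst l * p - snd l \<in> S} \<le> 2 * k * card L + (card P * w) * (card S * v)"
proof -
  obtain f where f: "mono_on P f" "\<And>p. p \<in> P \<Longrightarrow> f p < k"
      "\<And>p. p \<in> P \<Longrightarrow> card {p'\<in>P. f p' = f p} \<le> w"
    using ex_monotone_blocks[OF fin(1) w] by blast
  obtain g where g: "mono_on S g" "\<And>p. p \<in> S \<Longrightarrow> g p < k"
      "\<And>p. p \<in> S \<Longrightarrow> card {p'\<in>S. g p' = g p} \<le> v"
    using ex_monotone_blocks[OF fin(2) v] by blast
  define ht :: "real \<times> real \<Rightarrow> real \<Rightarrow> real" where "ht l p = fst l * p - snd l" for l p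
  define I where "I l = {p \<in> P. ht l p \<in> S}" for l
  define T where "T l = {(p, p'). p \<in> I l \<and> p' \<in> I l \<and> p \<noteq> p' \<and> f p = f p' \<and> g (ht l p) = g (ht l p')}" for l
  have finI: "finite (I l)" for l using fin by (auto simp: I_def)
  have finT: "finite (T l)" for l
    by (rule finite_subset[of _ "I l \<times> I l"]) (use finI in \<open>auto simp: T_def\<close>)
  have I: "card (I l) \<le> 2 * k + card (T l)" for l
  proof -
    \<comment> \<open>For slopes that are not positive the row index is reversed, so that
      \<open>f\<close> and \<open>c\<close> both grow weakly along the line. Then equal sums
      \<open>f p + c p\<close> force equal cells, and all sums are below
      \<open>2 * k\<close>.\<close>
    define c where "c p = (if fst l > 0 then g (ht l p) else k - 1 - g (ht l p))" for p
    have ck: "f p + c p < 2 * k" if "p \<in> I l" for p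
      using f(2)[of p] g(2)[of "ht l p"] that by (auto simp: c_def I_def)
    have le: "f p = f p' \<and> g (ht l p) = g (ht l p')"
      if "p \<in> I l" "p' \<in> I l" "p \<le> p'" "f p + c p = f p' + c p'" for p p'
    proof -
      have f_le: "f p \<le> f p'" using mono_onD[OF f(1)] that by (auto simp: I_def)
      have "c p \<le> c p'"
      proof (cases "fst l > 0")
        case True
        then have "ht l p \<le> ht l p'" using that by (simp add: ht_def)
        then show ?thesis using mono_onD[OF g(1)] that True by (auto simp: I_def c_def)
      next
        case False
        then have "ht l p' \<le> ht l p" using that by (simp add: ht_def mult_left_mono_neg)
        then have "g (ht l p') \<le> g (ht l p)" using mono_onD[OF g(1)] that by (auto simp: I_def)
        then show ?thesis using False by (auto simp: c_def)
      qed
      then have "f p = f p'" "c p = c p'" using f_le that(4) by auto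
      \<comment> \<open>Truncated subtraction makes \<open>k - 1 - g\<close> injective only for
        values of \<open>g\<close> below \<open>k\<close>.\<close>
      moreover have "g (ht l p) < k" "g (ht l p') < k" using that g(2) by (auto simp: I_def)
      ultimately show ?thesis by (auto simp: c_def split: if_splits)
    qed
    have "card (I l) \<le> 2 * k + card {(p, p'). p \<in> I l \<and> p' \<in> I l \<and> p \<noteq> p' \<and> f p + c p = f p' + c p'}"
      using card_le_colours_plus_pairs[OF finI, of l "\<lambda>p. f p + c p"] ck by blast
    also have "card {(p, p'). p \<in> I l \<and> p' \<in> I l \<and> p \<noteq> p' \<and> f p + c p = f p' + c p'} \<le> card (T l)"
    proof -
      have "f p = f p' \<and> g (ht l p) = g (ht l p')"
        if "p \<in> I l" "p' \<in> I l" "f p + c p = f p' + c p'" for p p'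
        using le[OF that(1,2) _ that(3)] le[OF that(2,1) _ that(3)[symmetric]] by (metis linear)
      then show ?thesis unfolding T_def by (intro card_mono[OF finT[unfolded T_def]]) blast
    qed
    finally show ?thesis by simp
  qed
  let ?EP = "{(p, p'). p \<in> P \<and> p' \<in> P \<and> f p = f p'}" and ?ES = "{(s, s'). s \<in> S \<and> s' \<in> S \<and> g s = g s'}"
  have finE: "finite ?EP" "finite ?ES"
    using fin by (auto intro: finite_subset[of _ "P \<times> P"] finite_subset[of _ "S \<times> S"])
  have "card (SIGMA l:L. T l) \<le> card (?EP \<times> ?ES)"
  proof (rule card_inj_on_le)
    let ?F = "\<lambda>(l, p, p'). ((p, p'), (ht l p, ht l p'))"
    show "inj_on ?F (SIGMA l:L. T l)"
    proof (rule inj_onI, clarsimp simp: T_def)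
      fix q b q' b' p p'
      assume "p \<noteq> p'" and e: "ht (q, b) p = ht (q', b') p" "ht (q, b) p' = ht (q', b') p'"
      have "(q - q') * (p - p') = 0" using e by (simp add: ht_def algebra_simps)
      then show "q = q' \<and> b = b'" using \<open>p \<noteq> p'\<close> e by (auto simp: ht_def)
    qed
    show "?F ` (SIGMA l:L. T l) \<subseteq> ?EP \<times> ?ES" by (auto simp: T_def I_def)
    show "finite (?EP \<times> ?ES)" using finE by blast
  qed
  also have "\<dots> \<le> (card P * w) * (card S * v)"
    unfolding card_cartesian_product using f(3) g(3) fin
    by (intro mult_le_mono card_eq_pairs_le) auto
  finally have T: "(\<Sum>l\<in>L. card (T l)) \<le> (card P * w) * (card S * v)"
    using fin finT by simp
  have "{(l, p). l \<in> L \<and> p \<in> P \<and> fst l * p - snd l \<in> S} = (SIGMA l:L. I l)"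
    by (auto simp: I_def ht_def)
  then have "card {(l, p). l \<in> L \<and> p \<in> P \<and> fst l * p - snd l \<in> S} = (\<Sum>l\<in>L. card (I l))"
    using fin finI by simp
  also have "\<dots> \<le> (\<Sum>l\<in>L. 2 * k + card (T l))" by (intro sum_mono I)
  also have "\<dots> = 2 * k * card L + (\<Sum>l\<in>L. card (T l))" by (simp add: sum.distrib)
  finally show ?thesis using T by simp
qed

text \<open>The width \<open>n div k + 1\<close> overshoots by at most \<open>k\<close>, and
  \<open>k \<le> n\<close> turns this into a factor of two.\<close>

lemma ex_block_size:
  assumes "1 \<le> k" "k \<le> n"
  obtains w :: nat where "w \<ge> 1" "n \<le> w * k" "w * k \<le> 2 * n"
proof
  let ?w = "n div k + 1"
  have a: "n div k * k \<le> n" "n < n div k * k + k"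
    using dividend_less_div_times[of k n] assms by auto
  then show "?w \<ge> 1" "n \<le> ?w * k" by auto
  show "?w * k \<le> 2 * n" using a(1) assms(2) unfolding distrib_right by linarith
qed

text \<open>The number \<open>k\<close> of blocks per side is chosen so that \<open>N\<close>
  absorbs the linear term of the grid bound. The other term gives
  \<open>N * k\<^sup>2 \<le> 8 * (card P * card S)\<^sup>2\<close>, where \<open>k\<close> is
  comparable to \<open>N / card L\<close>.\<close>

lemma szemeredi_trotter_grid:
  fixes P S :: "real set" and L :: "(real \<times> real) set"
  assumes fin: "finite P" "finite S" "finite L" and q0: "\<And>q b. (q, b) \<in> L \<Longrightarrow> q \<noteq> 0"
    and N_def: "N = card {(l, p). l \<in> L \<and> p \<in> P \<and> fst l * p - snd l \<in> S}"
    and large: "N \<ge> 4 * card L"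
  shows "N ^ 3 \<le> 512 * (card P * card S * card L)\<^sup>2"
proof (cases "card L = 0")
  case True
  then have "L = {}" using fin by auto
  then have "N = 0" by (simp add: N_def)
  then show ?thesis by simp
next
  case False
  \<comment> \<open>A line meets each column at most once and, its slope being nonzero, each row at
    most once. These trivial bounds keep \<open>k\<close> at most \<open>card P\<close> and
    \<open>card S\<close>, as \<open>ex_block_size\<close> requires.\<close>
  have NP: "N \<le> card L * card P"
  proof -
    have "N \<le> card (L \<times> P)" unfolding N_def using fin by (intro card_mono) auto
    then show ?thesis by (simp add: card_cartesian_product)
  qed
  have NS: "N \<le> card L * card S"
  proof -
    have "N \<le> card (L \<times> S)" unfolding N_def
    proof (rule card_inj_on_le)
      show "inj_on (\<lambda>(l, p). (l, fst l * p - snd l)) {(l, p). l \<in> L \<and> p \<in> P \<and> fst l * p - snd l \<in> S}"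
        using q0 by (fastforce simp: inj_on_def)
    qed (use fin in auto)
    then show ?thesis by (simp add: card_cartesian_product)
  qed
  \<comment> \<open>With this choice \<open>2 * k * card L\<close> is at most half of
    \<open>N\<close>. The hypothesis \<open>large\<close> makes \<open>k\<close> positive, so
    rounding down costs only a factor of two.\<close>
  define k where "k = N div (4 * card L)"
  have k1: "1 \<le> k" using large False by (simp add: k_def Suc_le_eq div_greater_zero_iff)
  have kN: "k * (4 * card L) \<le> N" "N < 2 * (k * (4 * card L))"
  proof -
    show "k * (4 * card L) \<le> N" by (simp add: k_def)
    have "N < k * (4 * card L) + 4 * card L" using dividend_less_div_times[of "4 * card L" N] False by (simp add: k_def)
    also have "\<dots> \<le> 2 * (k * (4 * card L))" using k1 by simp
    finally show "N < 2 * (k * (4 * card L))" .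
  qed
  have "card L * (4 * k) \<le> card L * card P" "card L * (4 * k) \<le> card L * card S"
    using kN(1) NP NS by (simp_all only: mult.assoc mult.commute mult.left_commute order_trans)
  then have kPS: "k \<le> card P" "k \<le> card S" using False by auto
  obtain w where w: "w \<ge> 1" "card P \<le> w * k" "w * k \<le> 2 * card P" using ex_block_size[OF k1 kPS(1)] by blast
  obtain v where v: "v \<ge> 1" "card S \<le> v * k" "v * k \<le> 2 * card S" using ex_block_size[OF k1 kPS(2)] by blast
  have "N \<le> 2 * k * card L + (card P * w) * (card S * v)"
    unfolding N_def by (rule grid_incidences_le) (use fin w v in auto)
  then have "N \<le> 2 * ((card P * w) * (card S * v))" using kN by linarith
  then have "N * k\<^sup>2 \<le> 2 * ((card P * w) * (card S * v)) * k\<^sup>2" by simp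
  also have "\<dots> = 2 * (card P * card S) * ((w * k) * (v * k))" by (simp add: power2_eq_square)
  also have "\<dots> \<le> 2 * (card P * card S) * ((2 * card P) * (2 * card S))"
    by (intro mult_le_mono order_refl w(3) v(3))
  finally have *: "N * k\<^sup>2 \<le> 8 * (card P * card S)\<^sup>2" by (simp add: power2_eq_square)
  have "N ^ 3 = N * N\<^sup>2" by (simp add: power3_eq_cube power2_eq_square)
  also have "\<dots> \<le> N * (2 * (k * (4 * card L)))\<^sup>2"
    using kN(2) by (intro mult_le_mono2 power_mono) simp_all
  also have "\<dots> = 64 * (card L)\<^sup>2 * (N * k\<^sup>2)" by (simp add: power2_eq_square)
  also have "\<dots> \<le> 64 * (card L)\<^sup>2 * (8 * (card P * card S)\<^sup>2)" using * by simp
  also have "\<dots> = 512 * (card P * card S * card L)\<^sup>2" by (simp add: power_mult_distrib)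
  finally show ?thesis .
qed

section \<open>Pigeonholing with a harmonic loss\<close>

text \<open>The \<open>j\<close>-th largest value is at most \<open>M / j\<close>, as at least
  \<open>j\<close> elements are no smaller. The induction removes the smallest value, whose
  superlevel set is all of \<open>Y\<close>.\<close>

lemma sum_le_harm_superlevel:
  fixes f :: "'a \<Rightarrow> real"
  assumes "finite Y" and "\<And>y. y \<in> Y \<Longrightarrow> 0 \<le> f y"
    and "\<And>y. y \<in> Y \<Longrightarrow> f y * real (card {z\<in>Y. f y \<le> f z}) \<le> M"
  shows "sum f Y \<le> M * harm (card Y)"
  using assms
proof (induction "card Y" arbitrary: Y)
  case 0
  then show ?case by (simp add: harm_def)
next
  case (Suc n)
  then have "Y \<noteq> {}" by auto
  then obtain y where y: "y \<in> Y" "\<And>z. z \<in> Y \<Longrightarrow> f y \<le> f z"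
    using arg_min_if_finite[of Y f] Suc.prems(1) by (meson not_le)
  have card: "card (Y - {y}) = n" using Suc y by simp
  have "{z \<in> Y. f y \<le> f z} = Y" using y by auto
  then have fy: "f y \<le> M / real (Suc n)"
    using Suc.prems(3)[OF y(1)] Suc.hyps(2) by (simp add: field_simps del: of_nat_Suc)
  have "f z * real (card {w \<in> Y - {y}. f z \<le> f w}) \<le> M" if z: "z \<in> Y - {y}" for z
  proof -
    have "card {w \<in> Y - {y}. f z \<le> f w} \<le> card {w \<in> Y. f z \<le> f w}"
      by (rule card_mono) (use Suc.prems in auto)
    then have "f z * real (card {w \<in> Y - {y}. f z \<le> f w}) \<le> f z * real (card {w \<in> Y. f z \<le> f w})"
      using Suc.prems(2) z by (intro mult_left_mono) auto
    then show ?thesis using Suc.prems(3)[of z] z by auto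
  qed
  then have "sum f (Y - {y}) \<le> M * harm n"
    using Suc.hyps(1)[of "Y - {y}"] card Suc.prems by auto
  moreover have "sum f Y = f y + sum f (Y - {y})" using Suc.prems(1) y(1) by (simp add: sum.remove)
  moreover have "M * harm (card Y) = M * harm n + M / real (Suc n)"
    using Suc.hyps(2)[symmetric] by (simp add: harm_Suc distrib_left divide_inverse)
  ultimately show ?case using fy by linarith
qed

text \<open>The bound \<open>M\<close> of the preceding lemma is taken to be the largest product of
  a value and the size of its superlevel set. All levels compete, not only dyadic ones, and one
  harmonic factor is lost.\<close>

lemma ex_large_superlevel:
  fixes f :: "'a \<Rightarrow> real"
  assumes "finite Y" "Y \<noteq> {}" and nonneg: "\<And>y. y \<in> Y \<Longrightarrow> 0 \<le> f y"
  shows "\<exists>y\<in>Y. sum f Y \<le> f y * real (card {z\<in>Y. f y \<le> f z}) * harm (card Y)"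
proof -
  define g where "g y = f y * real (card {z\<in>Y. f y \<le> f z})" for y
  obtain y where "y \<in> Y" "\<And>z. z \<in> Y \<Longrightarrow> g z \<le> g y"
    using ex_is_arg_min_if_finite[OF assms(1,2), where f = "\<lambda>y. - g y"] by (auto simp: is_arg_min_linorder)
  then show ?thesis using sum_le_harm_superlevel[where f = f and M = "g y", OF assms(1) nonneg] unfolding g_def by blast
qed

section \<open>Third moments\<close>

text \<open>A real-valued form of the energies, in which inequalities can be multiplied and divided
  freely. It is meaningful for finite support; otherwise the sum defaults to 0.\<close>

definition third_moment :: "('a \<Rightarrow> nat) \<Rightarrow> real" where
  "third_moment r = (\<Sum>x | r x \<noteq> 0. real (r x) ^ 3)"

lemma third_moment_nonneg: "0 \<le> third_moment r"
  by (simp add: third_moment_def sum_nonneg)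

lemma third_moment_eq_sum:
  assumes "finite D" "{x. r x \<noteq> 0} \<subseteq> D"
  shows "third_moment r = (\<Sum>x\<in>D. real (r x) ^ 3)"
  unfolding third_moment_def using assms by (intro sum.mono_neutral_left) auto

lemma infsum_cube_eq_third_moment:
  fixes r :: "'a \<Rightarrow> nat"
  assumes "finite {x. r x \<noteq> 0}"
  shows "(\<Sum>\<^sub>\<infinity>x\<in>UNIV. of_nat (r x) ^ 3 :: ennreal) = ennreal (third_moment r)"
proof -
  have "(\<Sum>\<^sub>\<infinity>x\<in>UNIV. of_nat (r x) ^ 3 :: ennreal) = (\<Sum>\<^sub>\<infinity>x\<in>{x. r x \<noteq> 0}. of_nat (r x) ^ 3)"
    by (rule infsum_cong_neutral) auto
  also have "\<dots> = (\<Sum>x | r x \<noteq> 0. of_nat (r x) ^ 3)" using assms by simp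
  also have "\<dots> = ennreal (third_moment r)"
    by (simp add: third_moment_def ennreal_of_nat_eq_real_of_nat ennreal_power flip: sum_ennreal)
  finally show ?thesis .
qed

lemma third_moment_mono:
  assumes "finite {x. s x \<noteq> 0}" "\<And>x. r x \<le> s x"
  shows "third_moment r \<le> third_moment s"
proof -
  have "{x. r x \<noteq> 0} \<subseteq> {x. s x \<noteq> 0}"
    using assms(2) by (intro Collect_mono) (metis le_zero_eq)
  then have "third_moment r = (\<Sum>x | s x \<noteq> 0. real (r x) ^ 3)"
    using assms(1) by (rule third_moment_eq_sum[rotated])
  also have "\<dots> \<le> third_moment s"
    unfolding third_moment_def using assms(2) by (intro sum_mono power_mono) auto
  finally show ?thesis .
qed

text \<open>This is convexity of the cube with weights \<open>a\<close> and \<open>b\<close>, applied to \<open>u / a\<close> and \<open>v / b\<close>.\<close>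

lemma cube_add_le_weighted:
  fixes a b u v :: real
  assumes "a > 0" "b > 0" "u \<ge> 0" "v \<ge> 0"
  shows "(u + v) ^ 3 \<le> (a + b)\<^sup>2 * (u ^ 3 / a\<^sup>2 + v ^ 3 / b\<^sup>2)"
proof -
  define p q where "p = u / a" and "q = v / b"
  have uv: "u = a * p" "v = b * q" and pq: "p \<ge> 0" "q \<ge> 0"
    using assms by (auto simp: p_def q_def)
  \<comment> \<open>The defect in the convexity inequality vanishes to second order at
    \<open>p = q\<close>, which gives the square as a factor.\<close>
  have "(a + b)\<^sup>2 * (a * p ^ 3 + b * q ^ 3) - (a * p + b * q) ^ 3
      = a * b * (p - q)\<^sup>2 * (a * (2 * p + q) + b * (p + 2 * q))"
    by algebra
  also have "\<dots> \<ge> 0" using assms pq by simp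
  finally have "(a * p + b * q) ^ 3 \<le> (a + b)\<^sup>2 * (a * p ^ 3 + b * q ^ 3)" by simp
  moreover have "u ^ 3 / a\<^sup>2 = a * p ^ 3" "v ^ 3 / b\<^sup>2 = b * q ^ 3"
    using assms by (simp_all add: uv power_mult_distrib power3_eq_cube power2_eq_square)
  ultimately show ?thesis using uv by simp
qed

text \<open>The weights stay free. If they are the sizes of two disjoint sets, bounds proportional
  to the cubes of these sizes add up to one proportional to \<open>(a + b) ^ 3\<close> without
  loss.\<close>

lemma third_moment_add_le:
  fixes a b :: real
  assumes "finite {x. r x \<noteq> 0}" "finite {x. s x \<noteq> 0}" and ab: "a > 0" "b > 0"
    and le: "\<And>x. t x \<le> r x + s x"
  shows "third_moment t \<le> (a + b)\<^sup>2 * (third_moment r / a\<^sup>2 + third_moment s / b\<^sup>2)"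
proof -
  let ?D = "{x. r x \<noteq> 0} \<union> {x. s x \<noteq> 0}"
  have D: "finite ?D" using assms by auto
  have t0: "{x. t x \<noteq> 0} \<subseteq> ?D"
  proof
    fix x assume "x \<in> {x. t x \<noteq> 0}"
    then show "x \<in> ?D" using le[of x] by auto
  qed
  have "third_moment t = (\<Sum>x\<in>?D. real (t x) ^ 3)" by (rule third_moment_eq_sum[OF D t0])
  also have "\<dots> \<le> (\<Sum>x\<in>?D. (real (r x) + real (s x)) ^ 3)"
    using le by (intro sum_mono power_mono) (auto simp flip: of_nat_add)
  also have "\<dots> \<le> (\<Sum>x\<in>?D. (a + b)\<^sup>2 * (real (r x) ^ 3 / a\<^sup>2 + real (s x) ^ 3 / b\<^sup>2))"
    using ab by (intro sum_mono cube_add_le_weighted) auto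
  also have "\<dots> = (a + b)\<^sup>2 * ((\<Sum>x\<in>?D. real (r x) ^ 3) / a\<^sup>2 + (\<Sum>x\<in>?D. real (s x) ^ 3) / b\<^sup>2)"
    by (simp add: sum.distrib sum_divide_distrib flip: sum_distrib_left)
  also have "\<dots> = (a + b)\<^sup>2 * (third_moment r / a\<^sup>2 + third_moment s / b\<^sup>2)"
    using third_moment_eq_sum[OF D, of r] third_moment_eq_sum[OF D, of s] by simp
  finally show ?thesis .
qed

text \<open>The cubes of \<open>k\<close> and \<open>k - 1\<close> differ by at most
  \<open>3 * k\<^sup>2\<close>; this splits a third moment into levels.\<close>

lemma cube_le_sum_squares: "real n ^ 3 \<le> 3 * (\<Sum>k=1..n. real k ^ 2)"
proof (induction n)
  case (Suc n)
  have "real (Suc n) ^ 3 \<le> real n ^ 3 + 3 * real (Suc n) ^ 2"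
    by (simp add: power2_eq_square power3_eq_cube algebra_simps)
  then show ?case using Suc by simp
qed simp

text \<open>Level \<open>j\<close> contributes at most three times \<open>?g j / j\<close>.
  Replacing each \<open>?g j\<close> by the maximum leaves the harmonic sum over the levels.\<close>

lemma third_moment_superlevel:
  assumes fin: "finite {x. r x \<noteq> 0}" and bound: "\<And>x. r x \<le> n" and "n \<ge> 1"
  shows "\<exists>k\<in>{1..n}. third_moment r \<le> 3 * harm n * real k ^ 3 * real (card {x. k \<le> r x})"
proof -
  let ?D = "{x. r x \<noteq> 0}"
  let ?g = "\<lambda>k. real k ^ 3 * real (card {x. k \<le> r x})"
  obtain k where k: "k \<in> {1..n}" "\<And>j. j \<in> {1..n} \<Longrightarrow> ?g j \<le> ?g k"
    using ex_is_arg_min_if_finite[of "{1..n}" "\<lambda>k. - (?g k)"] \<open>n \<ge> 1\<close>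
    by (auto simp: is_arg_min_linorder)
  have "third_moment r \<le> (\<Sum>x\<in>?D. 3 * (\<Sum>j=1..r x. real j ^ 2))"
    unfolding third_moment_def by (intro sum_mono cube_le_sum_squares)
  also have "\<dots> = (\<Sum>x\<in>?D. 3 * (\<Sum>j=1..n. if j \<le> r x then real j ^ 2 else 0))"
  proof -
    have "{1..r x} = {j \<in> {1..n}. j \<le> r x}" for x using bound[of x] by auto
    then have "(\<Sum>j=1..r x. real j ^ 2) = (\<Sum>j=1..n. if j \<le> r x then real j ^ 2 else 0)" for x
      by (simp only: sum.inter_filter finite_atLeastAtMost)
    then show ?thesis by simp
  qed
  also have "\<dots> = 3 * (\<Sum>j=1..n. \<Sum>x\<in>?D. if j \<le> r x then real j ^ 2 else 0)"
    unfolding sum_distrib_left[symmetric] by (subst sum.swap) simp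
  also have "\<dots> = 3 * (\<Sum>j=1..n. inverse (real j) * ?g j)"
  proof (intro arg_cong[where f = "\<lambda>y. 3 * y"] sum.cong refl)
    fix j assume j: "j \<in> {1..n}"
    then have "{x \<in> ?D. j \<le> r x} = {x. j \<le> r x}" by auto
    then have "(\<Sum>x\<in>?D. if j \<le> r x then real j ^ 2 else 0) = real (card {x. j \<le> r x}) * real j ^ 2"
      using fin by (simp flip: sum.inter_filter)
    then show "(\<Sum>x\<in>?D. if j \<le> r x then real j ^ 2 else 0) = inverse (real j) * ?g j"
      using j by (simp add: field_simps power2_eq_square power3_eq_cube)
  qed
  also have "\<dots> \<le> 3 * (\<Sum>j=1..n. inverse (real j) * ?g k)"
    using k(2) by (intro mult_left_mono sum_mono) auto
  also have "\<dots> = 3 * harm n * ?g k"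
    by (simp add: harm_def sum_distrib_right)
  finally show ?thesis using k(1) by (auto simp: mult.assoc)
qed

section \<open>Supports and sizes of the representation functions\<close>

lemma rep_diff_eq_0:
  assumes "x \<notin> (\<lambda>(a, b). a - b) ` (A \<times> B)"
  shows "rep_diff A B x = 0"
proof -
  have "{(a, b). a \<in> A \<and> b \<in> B \<and> x = a - b} = {}" using assms by auto
  then show ?thesis by (simp only: rep_diff_def card.empty)
qed

lemma finite_rep_diff_support:
  assumes "finite A" "finite B"
  shows "finite {x. rep_diff A B x \<noteq> 0}"
proof (rule finite_subset)
  show "{x. rep_diff A B x \<noteq> 0} \<subseteq> (\<lambda>(a, b). a - b) ` (A \<times> B)"
    by (rule subsetI, rule ccontr) (simp add: rep_diff_eq_0)
qed (use assms in auto)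

lemma rep_ratio_eq_0:
  assumes "0 \<notin> A" "x \<notin> (\<lambda>(a, b). a / b) ` (A \<times> B)"
  shows "rep_ratio A B x = 0"
proof -
  have "x \<in> (\<lambda>(a, b). a / b) ` (A \<times> B)" if "a \<in> A" "b \<in> B" "a = x * b" for a b
  proof -
    have "b \<noteq> 0" using that assms(1) by auto
    then have "x = a / b" using that(3) by simp
    then show ?thesis using that(1,2) by blast
  qed
  then have "{(a, b). a \<in> A \<and> b \<in> B \<and> a = x * b} = {}" using assms(2) by blast
  then show ?thesis by (simp only: rep_ratio_def card.empty)
qed

lemma finite_rep_ratio_support:
  assumes "finite A" "finite B" "0 \<notin> A"
  shows "finite {x. rep_ratio A B x \<noteq> 0}"
proof (rule finite_subset)
  show "{x. rep_ratio A B x \<noteq> 0} \<subseteq> (\<lambda>(a, b). a / b) ` (A \<times> B)"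
    by (rule subsetI, rule ccontr) (simp add: rep_ratio_eq_0 assms(3))
qed (use assms in auto)

lemma rep_diff_le_left:
  assumes "finite A"
  shows "rep_diff A B x \<le> card A"
  unfolding rep_diff_def by (rule card_inj_on_le[where f = fst]) (use assms in \<open>auto simp: inj_on_def\<close>)

lemma rep_diff_le_right:
  assumes "finite B"
  shows "rep_diff A B x \<le> card B"
  unfolding rep_diff_def by (rule card_inj_on_le[where f = snd]) (use assms in \<open>auto simp: inj_on_def\<close>)

text \<open>In \<open>a = x * b\<close> a nonzero \<open>a\<close> forces \<open>x\<close> to be
  nonzero, so \<open>a\<close> determines \<open>b\<close>.\<close>

lemma rep_ratio_le_left:
  assumes "finite A" "0 \<notin> A"
  shows "rep_ratio A B x \<le> card A"
  unfolding rep_ratio_def by (rule card_inj_on_le[where f = fst]) (use assms in \<open>auto simp: inj_on_def\<close>)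

lemma rep_diff_Un_le: "rep_diff (X \<union> Y) B x \<le> rep_diff X B x + rep_diff Y B x"
proof -
  have "{(a, b). a \<in> X \<union> Y \<and> b \<in> B \<and> x = a - b}
      = {(a, b). a \<in> X \<and> b \<in> B \<and> x = a - b} \<union> {(a, b). a \<in> Y \<and> b \<in> B \<and> x = a - b}" by auto
  then show ?thesis by (simp only: rep_diff_def card_Un_le)
qed

lemma rep_ratio_mono:
  assumes "finite Y" "finite B" "X \<subseteq> Y"
  shows "rep_ratio X B x \<le> rep_ratio Y B x"
  unfolding rep_ratio_def
proof (rule card_mono)
  show "finite {(a, b). a \<in> Y \<and> b \<in> B \<and> a = x * b}"
    by (rule finite_subset[of _ "Y \<times> B"]) (use assms in auto)
qed (use assms in auto)

section \<open>Additive energy of sets rich in products\<close>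

lemma mult_card_le_card_Sigma:
  assumes "finite D" "\<And>d. d \<in> D \<Longrightarrow> finite (F d)" "\<And>d. d \<in> D \<Longrightarrow> m \<le> card (F d)"
  shows "m * card D \<le> card (SIGMA d:D. F d)"
proof -
  have "m * card D = (\<Sum>d\<in>D. m)" by simp
  also have "\<dots> \<le> (\<Sum>d\<in>D. card (F d))" using assms(3) by (rule sum_mono)
  also have "\<dots> = card (SIGMA d:D. F d)" using assms(1,2) by simp
  finally show ?thesis .
qed

text \<open>If \<open>s = x - b\<close> and \<open>x = q * p\<close>, then the point \<open>(p, s)\<close> lies on the line with slope \<open>q\<close> and
  intercept \<open>- b\<close>. So each \<open>s\<close> with many representations yields many incidences.\<close>

lemma card_rep_diff_superlevel_le:
  fixes P Q X B :: "real set"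
  assumes fin: "finite P" "finite Q" "finite X" "finite B" and "0 \<notin> Q" "0 \<notin> X"
    and reps: "\<And>x. x \<in> X \<Longrightarrow> t \<le> card {(q, p). q \<in> Q \<and> p \<in> P \<and> x = q * p}"
    and "u \<ge> 1"
  shows "(t * u) ^ 3 * card {x. u \<le> rep_diff X B x} \<le> 512 * (card P * card Q * card B)\<^sup>2"
proof -
  define S where "S = {x. u \<le> rep_diff X B x}"
  define F where "F x = {(q, p). q \<in> Q \<and> p \<in> P \<and> x = q * p}" for x
  define G where "G s = {(a, b). a \<in> X \<and> b \<in> B \<and> s = a - b}" for s
  define Z where "Z = {(a, b). a \<in> X \<and> b \<in> B \<and> a - b \<in> S}"
  define N where "N = card {(l, p). l \<in> Q \<times> B \<and> p \<in> P \<and> fst l * p - snd l \<in> S}"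
  have finS: "finite S"
    using finite_rep_diff_support[OF fin(3,4)]
    by (rule rev_finite_subset) (use \<open>u \<ge> 1\<close> in \<open>auto simp: S_def\<close>)
  have finF: "finite (F x)" for x
    by (rule finite_subset[of _ "Q \<times> P"]) (use fin in \<open>auto simp: F_def\<close>)
  have finG: "finite (G s)" for s
    by (rule finite_subset[of _ "X \<times> B"]) (use fin in \<open>auto simp: G_def\<close>)
  have finZ: "finite Z"
    by (rule finite_subset[of _ "X \<times> B"]) (use fin in \<open>auto simp: Z_def\<close>)
  \<comment> \<open>Double counting in two stages: each \<open>s\<close> in \<open>S\<close> carries
    at least \<open>u\<close> pairs of \<open>Z\<close>, and the first entry of each pair has at
    least \<open>t\<close> factorisations. Together they give \<open>t * u * card S\<close>
    incidences.\<close>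
  have "u * card S \<le> card (SIGMA s:S. G s)"
    by (rule mult_card_le_card_Sigma[OF finS finG]) (auto simp: S_def G_def rep_diff_def)
  also have "\<dots> \<le> card Z"
    by (rule card_inj_on_le[where f = snd]) (use finZ in \<open>auto simp: inj_on_def G_def Z_def\<close>)
  finally have Z: "u * card S \<le> card Z" .
  have "t * card Z \<le> card (SIGMA z:Z. F (fst z))"
    by (rule mult_card_le_card_Sigma[OF finZ]) (use reps finF in \<open>auto simp: Z_def F_def\<close>)
  also have "\<dots> \<le> N"
    unfolding N_def
  proof (rule card_inj_on_le)
    show "finite {(l, p). l \<in> Q \<times> B \<and> p \<in> P \<and> fst l * p - snd l \<in> S}"
      by (rule finite_subset[of _ "(Q \<times> B) \<times> P"]) (use fin in auto)
    \<comment> \<open>Dropping \<open>x\<close> loses nothing, because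
      \<open>x = q * p\<close>.\<close>
    show "inj_on (\<lambda>((x, b), (q, p)). ((q, b), p)) (SIGMA z:Z. F (fst z))"
      by (auto simp: inj_on_def F_def)
  qed (auto simp: Z_def F_def)
  finally have "t * (u * card S) \<le> N"
    using Z by (meson mult_le_mono2 order_trans)
  then have N: "t * u * card S \<le> N" by (simp add: mult.assoc)
  show ?thesis
  proof (cases "S = {} \<or> X = {}")
    case True
    then have "card S = 0"
    proof
      assume "X = {}"
      then have "rep_diff X B x = 0" for x by (simp add: rep_diff_def)
      then show "card S = 0" using \<open>u \<ge> 1\<close> by (simp add: S_def)
    qed simp
    then show ?thesis by (simp add: S_def)
  next
    case False
    then obtain s x where s: "s \<in> S" and x: "x \<in> X" by blast
    have cS: "card S > 0" using s finS by (auto simp: card_gt_0_iff)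
    show ?thesis
    proof (cases "N \<ge> 4 * card (Q \<times> B)")
      case True
      have "N ^ 3 \<le> 512 * (card P * card S * card (Q \<times> B))\<^sup>2"
        by (rule szemeredi_trotter_grid[OF fin(1) finS _ _ N_def True]) (use fin \<open>0 \<notin> Q\<close> in auto)
      then have "(t * u * card S) ^ 3 \<le> 512 * (card P * card S * card (Q \<times> B))\<^sup>2"
        using power_mono[OF N, of 3] by (meson le0 order_trans)
      then have "((t * u) ^ 3 * card S) * (card S)\<^sup>2 \<le> (512 * (card P * card Q * card B)\<^sup>2) * (card S)\<^sup>2"
        by (simp add: card_cartesian_product power_mult_distrib power2_eq_square power3_eq_cube ac_simps)
      then show ?thesis using cS unfolding S_def by simp
    next
      case False
      \<comment> \<open>There are too few incidences for Szemeredi-Trotter, so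
        \<open>t * u * card S\<close> is at most \<open>4 * (card Q * card B)\<close>. Two trivial
        bounds for \<open>t * u\<close> supply the remaining factors.\<close>
      have "u \<le> card X" "u \<le> card B"
        using s rep_diff_le_left[OF fin(3), of B s] rep_diff_le_right[OF fin(4), of X s]
        by (auto simp: S_def)
      have "t \<le> card P"
      proof -
        have "card (F x) \<le> card P"
          by (rule card_inj_on_le[where f = snd])
            (use fin x \<open>0 \<notin> X\<close> in \<open>auto simp: inj_on_def F_def\<close>)
        then show ?thesis using reps[OF x] by (simp add: F_def)
      qed
      have "t * card X \<le> card (SIGMA x:X. F x)"
        by (rule mult_card_le_card_Sigma[OF fin(3) finF]) (use reps in \<open>auto simp: F_def\<close>)
      also have "\<dots> \<le> card (Q \<times> P)"
        by (rule card_inj_on_le[where f = snd]) (use fin in \<open>auto simp: inj_on_def F_def\<close>)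
      finally have "t * u \<le> card P * card Q"
        using \<open>u \<le> card X\<close> by (metis card_cartesian_product mult.commute mult_le_mono2 order_trans)
      moreover have "t * u \<le> card P * card B" using \<open>t \<le> card P\<close> \<open>u \<le> card B\<close> by (rule mult_le_mono)
      ultimately have sq: "(t * u) * (t * u) \<le> (card P * card Q) * (card P * card B)" by (rule mult_le_mono)
      have "t * u * card S \<le> 4 * (card Q * card B)"
        using N False by (simp add: card_cartesian_product)
      then have "(t * u * card S) * ((t * u) * (t * u))
          \<le> (4 * (card Q * card B)) * ((card P * card Q) * (card P * card B))"
        using sq by (rule mult_le_mono)
      then have "(t * u) ^ 3 * card S \<le> 4 * (card P * card Q * card B)\<^sup>2"
        by (simp add: power2_eq_square power3_eq_cube ac_simps)
      then show ?thesis unfolding S_def by simp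
    qed
  qed
qed

text \<open>The superlevel bound is applied at the level \<open>u\<close> that dominates the third
  moment; \<open>1536\<close> is \<open>3 * 512\<close>.\<close>

lemma third_moment_rep_diff_le:
  fixes P Q X B :: "real set"
  assumes fin: "finite P" "finite Q" "finite X" "finite B" and "0 \<notin> Q" "0 \<notin> X" "X \<noteq> {}"
    and reps: "\<And>x. x \<in> X \<Longrightarrow> t \<le> card {(q, p). q \<in> Q \<and> p \<in> P \<and> x = q * p}"
  shows "third_moment (rep_diff X B) * real t ^ 3
    \<le> 1536 * harm (card X) * (real (card P) * real (card Q) * real (card B))\<^sup>2"
proof -
  have n: "card X \<ge> 1" using fin \<open>X \<noteq> {}\<close> by (simp add: Suc_le_eq card_gt_0_iff)
  obtain u where u: "u \<in> {1..card X}"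
      "third_moment (rep_diff X B) \<le> 3 * harm (card X) * real u ^ 3 * real (card {x. u \<le> rep_diff X B x})"
    using third_moment_superlevel[OF finite_rep_diff_support[OF fin(3,4)] rep_diff_le_left[OF fin(3)] n]
    by blast
  have "real ((t * u) ^ 3 * card {x. u \<le> rep_diff X B x}) \<le> real (512 * (card P * card Q * card B)\<^sup>2)"
    using card_rep_diff_superlevel_le[OF fin assms(5,6) reps, of u] u(1) unfolding of_nat_le_iff by simp
  then have *: "real u ^ 3 * real (card {x. u \<le> rep_diff X B x}) * real t ^ 3
      \<le> 512 * (real (card P) * real (card Q) * real (card B))\<^sup>2"
    by (simp add: power_mult_distrib ac_simps)
  have "third_moment (rep_diff X B) * real t ^ 3
      \<le> (3 * harm (card X) * real u ^ 3 * real (card {x. u \<le> rep_diff X B x})) * real t ^ 3"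
    using u(2) by (rule mult_right_mono) simp
  also have "\<dots> = 3 * harm (card X) * (real u ^ 3 * real (card {x. u \<le> rep_diff X B x}) * real t ^ 3)"
    by simp
  also have "\<dots> \<le> 3 * harm (card X) * (512 * (real (card P) * real (card Q) * real (card B))\<^sup>2)"
    using * by (rule mult_left_mono) (simp add: harm_nonneg)
  finally show ?thesis by simp
qed

section \<open>Extraction of one subset\<close>

text \<open>The supremum need not be attained, but it is positive, so some value exceeds half of
  it.\<close>

lemma ex_half_maximal:
  fixes f :: "'a \<Rightarrow> real"
  assumes bdd: "\<And>b. b \<in> C \<Longrightarrow> f b \<le> M" and "b1 \<in> C" "f b1 > 0"
  obtains b0 where "b0 \<in> C" "f b0 > 0" "\<And>b. b \<in> C \<Longrightarrow> f b \<le> 2 * f b0"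
proof -
  let ?s = "SUP b\<in>C. f b"
  have bdd': "bdd_above (f ` C)" using bdd by (rule bdd_aboveI2)
  have le: "f b \<le> ?s" if "b \<in> C" for b using that bdd' by (rule cSUP_upper)
  then have "?s / 2 < ?s" using assms(2,3) by force
  then obtain b0 where "b0 \<in> C" "?s / 2 < f b0" using less_cSUP_iff[OF _ bdd'] assms(2) by blast
  then show ?thesis using le assms(2,3) by (intro that[of b0]) (force+)
qed

lemma rep_ratio_pos:
  assumes "finite A" "finite B" "a \<in> A" "b \<in> B" "a = x * b"
  shows "rep_ratio A B x \<noteq> 0"
proof -
  have "finite {(a, b). a \<in> A \<and> b \<in> B \<and> a = x * b}"
    by (rule finite_subset[of _ "A \<times> B"]) (use assms in auto)
  moreover have "(a, b) \<in> {(a, b). a \<in> A \<and> b \<in> B \<and> a = x * b}" using assms by auto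
  ultimately show ?thesis unfolding rep_ratio_def card_eq_0_iff by blast
qed

lemma third_moment_pos:
  assumes "finite {x. r x \<noteq> 0}" "r x \<noteq> 0"
  shows "third_moment r > 0"
  unfolding third_moment_def by (rule sum_pos2[OF assms(1), of x]) (use assms in auto)

text \<open>At most \<open>card A * card B\<close> ratios occur, each at most \<open>card A\<close>
  times. This crude bound serves to keep the supremum over \<open>B\<close> finite.\<close>

lemma third_moment_rep_ratio_le:
  assumes "finite A" "finite B" "0 \<notin> A"
  shows "third_moment (rep_ratio A B) \<le> real (card A) ^ 4 * real (card B)"
proof -
  let ?D = "(\<lambda>(a, b). a / b) ` (A \<times> B)"
  have "third_moment (rep_ratio A B) = (\<Sum>x\<in>?D. real (rep_ratio A B x) ^ 3)"
  proof (rule third_moment_eq_sum)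
    show "{x. rep_ratio A B x \<noteq> 0} \<subseteq> ?D"
      by (rule subsetI, rule ccontr) (simp add: rep_ratio_eq_0 assms(3))
  qed (use assms in auto)
  also have "\<dots> \<le> real (card ?D) * real (card A) ^ 3"
    using rep_ratio_le_left[OF assms(1,3)] by (intro sum_bounded_above power_mono) auto
  also have "card ?D \<le> card A * card B"
    using card_image_le[of "A \<times> B" "\<lambda>(a, b). a / b"] assms(1,2) by (simp add: card_cartesian_product)
  then have "real (card ?D) * real (card A) ^ 3 \<le> real (card A * card B) * real (card A) ^ 3"
    by (intro mult_right_mono) (simp_all only: of_nat_le_iff, simp)
  finally show ?thesis by (simp add: power3_eq_cube power4_eq_xxxx ac_simps)
qed

text \<open>Elimination of the auxiliary sizes: \<open>b0\<close> and \<open>s\<close> are the sizes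
  of the near-extremal set and of its set of popular ratios, \<open>k\<close> and \<open>t\<close>
  the two richness thresholds, \<open>x\<close> the size of the extracted set. Multiplying
  \<open>A4\<close>, \<open>A1\<close> and \<open>A2\<close> produces \<open>(k * s) ^ 3\<close>,
  which \<open>A3\<close> turns into \<open>(t * x * H) ^ 3\<close>; then \<open>t\<close>,
  \<open>b0\<close> and \<open>s\<close> cancel. The constant is
  \<open>1536 * 2 * 3\<close>.\<close>

lemma energy_product_arith:
  fixes e g g0 H k s x t b b0 b' :: real
  assumes A1: "g * b0\<^sup>2 \<le> 2 * g0 * b'\<^sup>2" and A2: "g0 \<le> 3 * H * k ^ 3 * s"
    and A3: "k * s \<le> t * x * H" and A4: "e * t ^ 3 \<le> 1536 * H * (b0 * s * b)\<^sup>2"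
    and pos: "t > 0" "s > 0" "b0 > 0" and nonneg: "H \<ge> 0" "k \<ge> 0" "x \<ge> 0" "e \<ge> 0" "g \<ge> 0"
  shows "e * g \<le> 9216 * H ^ 5 * x ^ 3 * b\<^sup>2 * b'\<^sup>2"
proof (rule mult_right_le_imp_le)
  have "(e * g) * (t ^ 3 * b0\<^sup>2 * s\<^sup>2) = (e * t ^ 3) * (g * b0\<^sup>2) * s\<^sup>2" by algebra
  also have "\<dots> \<le> (1536 * H * (b0 * s * b)\<^sup>2) * (2 * (3 * H * k ^ 3 * s) * b'\<^sup>2) * s\<^sup>2"
  proof (rule mult_right_mono[OF mult_mono[OF A4]])
    have "2 * g0 * b'\<^sup>2 \<le> 2 * (3 * H * k ^ 3 * s) * b'\<^sup>2" 
      by (rule mult_right_mono) (use A2 in linarith, simp)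
    then show "g * b0\<^sup>2 \<le> 2 * (3 * H * k ^ 3 * s) * b'\<^sup>2" using A1 by linarith
  qed (use pos nonneg in auto)
  also have "\<dots> = 9216 * H\<^sup>2 * (b0 * s * b)\<^sup>2 * b'\<^sup>2 * (k * s) ^ 3" by algebra
  also have "\<dots> \<le> 9216 * H\<^sup>2 * (b0 * s * b)\<^sup>2 * b'\<^sup>2 * (t * x * H) ^ 3"
    using A3 pos nonneg by (intro mult_left_mono power_mono) auto
  also have "\<dots> = (9216 * H ^ 5 * x ^ 3 * b\<^sup>2 * b'\<^sup>2) * (t ^ 3 * b0\<^sup>2 * s\<^sup>2)" by algebra
  finally show "(e * g) * (t ^ 3 * b0\<^sup>2 * s\<^sup>2)
    \<le> (9216 * H ^ 5 * x ^ 3 * b\<^sup>2 * b'\<^sup>2) * (t ^ 3 * b0\<^sup>2 * s\<^sup>2)" .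
qed (use pos in auto)

text \<open>The set \<open>X\<close> is built from one near-extremal \<open>B0\<close> and hence
  serves all \<open>B\<close> and \<open>B'\<close>: near-extremality handles \<open>B'\<close>, and
  the products of popular ratios with elements of \<open>B0\<close> handle \<open>B\<close>.\<close>

lemma ex_subset_energy_product_le:
  fixes Y :: "real set"
  assumes Y: "finite Y" "Y \<noteq> {}" "0 \<notin> Y"
  obtains X where "X \<subseteq> Y" "X \<noteq> {}"
    "\<And>B B'. finite B \<Longrightarrow> finite B' \<Longrightarrow> B' \<noteq> {} \<Longrightarrow>
      third_moment (rep_diff X B) * third_moment (rep_ratio Y B')
        \<le> 9216 * harm (card Y) ^ 5 * real (card X) ^ 3 * (real (card B))\<^sup>2 * (real (card B'))\<^sup>2"
proof -
  define H :: real where "H = harm (card Y)"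
  define D where "D B' = third_moment (rep_ratio Y B') / (real (card B'))\<^sup>2" for B'
  let ?C = "{B :: real set. finite B \<and> B \<noteq> {}}"
  obtain y1 where y1: "y1 \<in> Y" using Y by blast
  have "D B \<le> real (card Y) ^ 4" if "B \<in> ?C" for B
  proof -
    have c: "real (card B) \<ge> 1" using that by (simp add: Suc_le_eq card_gt_0_iff)
    have "third_moment (rep_ratio Y B) \<le> real (card Y) ^ 4 * real (card B)"
      using that Y by (intro third_moment_rep_ratio_le) auto
    also have "\<dots> \<le> real (card Y) ^ 4 * (real (card B))\<^sup>2"
      using c by (intro mult_left_mono) (auto simp: power2_eq_square)
    finally show ?thesis using c by (simp add: D_def divide_le_eq)
  qed
  moreover have "D {1} > 0"
  proof -
    have "third_moment (rep_ratio Y {1}) > 0"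
      by (rule third_moment_pos[OF finite_rep_ratio_support rep_ratio_pos[of _ _ y1 1 y1]]) (use Y y1 in auto)
    then show ?thesis by (simp add: D_def)
  qed
  ultimately obtain B0 where B0: "B0 \<in> ?C" "D B0 > 0" and max: "\<And>B. B \<in> ?C \<Longrightarrow> D B \<le> 2 * D B0"
    using ex_half_maximal[of ?C D "real (card Y) ^ 4" "{1}"] by blast
  have finB0: "finite B0" and cB0: "real (card B0) > 0" using B0 by (auto simp: card_gt_0_iff)
  have g0: "third_moment (rep_ratio Y B0) > 0" using B0(2) cB0 by (simp add: D_def zero_less_divide_iff)
  have supp: "finite {x. rep_ratio Y B0 x \<noteq> 0}" using Y finB0 by (intro finite_rep_ratio_support)
  have n: "card Y \<ge> 1" using Y by (simp add: Suc_le_eq card_gt_0_iff)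
  obtain k where k: "k \<in> {1..card Y}"
      "third_moment (rep_ratio Y B0) \<le> 3 * H * real k ^ 3 * real (card {x. k \<le> rep_ratio Y B0 x})"
    unfolding H_def using third_moment_superlevel[OF supp rep_ratio_le_left[OF Y(1,3)] n] by blast
  define S where "S = {x. k \<le> rep_ratio Y B0 x}"
  have finS: "finite S"
    using supp by (rule rev_finite_subset) (use k in \<open>auto simp: S_def\<close>)
  have cS: "real (card S) > 0"
    using k(2) g0 unfolding S_def[symmetric] by (cases "card S = 0") auto
  have S0: "0 \<notin> S"
  proof -
    have "{(a, b). a \<in> Y \<and> b \<in> B0 \<and> a = 0 * b} = {}" using Y by auto
    then have "rep_ratio Y B0 0 = 0" by (simp only: rep_ratio_def card.empty)
    then show ?thesis using k by (simp add: S_def)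
  qed
  define F where "F y = {(q, p). q \<in> S \<and> p \<in> B0 \<and> y = q * p}" for y
  define G where "G x = {(a, b). a \<in> Y \<and> b \<in> B0 \<and> a = x * b}" for x
  have finF: "finite (F y)" for y
    by (rule finite_subset[of _ "S \<times> B0"]) (use finS finB0 in \<open>auto simp: F_def\<close>)
  have finG: "finite (G y)" for y
    by (rule finite_subset[of _ "Y \<times> B0"]) (use Y finB0 in \<open>auto simp: G_def\<close>)
  \<comment> \<open>The triples with \<open>a = x * b\<close> and \<open>x\<close> in
    \<open>S\<close> are counted by ratio first and then regrouped by the element \<open>a\<close>
    of \<open>Y\<close>.\<close>
  have "k * card S \<le> card (SIGMA x:S. G x)"
    by (rule mult_card_le_card_Sigma[OF finS finG]) (auto simp: S_def G_def rep_ratio_def)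
  also have "\<dots> \<le> card (SIGMA y:Y. F y)"
  proof (rule card_inj_on_le)
    show "inj_on (\<lambda>(x, (a, b)). (a, (x, b))) (SIGMA x:S. G x)" by (auto simp: inj_on_def)
    show "finite (SIGMA y:Y. F y)" using Y finF by blast
  qed (auto simp: F_def G_def)
  also have "\<dots> = (\<Sum>y\<in>Y. card (F y))" using Y finF by simp
  finally have kS: "real k * real (card S) \<le> (\<Sum>y\<in>Y. real (card (F y)))"
    by (metis of_nat_le_iff of_nat_mult of_nat_sum)
  obtain y where y: "y \<in> Y" "(\<Sum>y\<in>Y. real (card (F y)))
      \<le> real (card (F y)) * real (card {z\<in>Y. real (card (F y)) \<le> real (card (F z))}) * H"
    unfolding H_def using ex_large_superlevel[OF Y(1,2), of "\<lambda>y. real (card (F y))"] by auto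
  define t where "t = card (F y)"
  define X where "X = {z\<in>Y. t \<le> card (F z)}"
  have A3: "real k * real (card S) \<le> real t * real (card X) * H"
    using kS y(2) by (simp add: X_def t_def)
  \<comment> \<open>Positivity of \<open>t\<close> allows \<open>t ^ 3\<close> to be cancelled in
    the final arithmetic.\<close>
  have "real k * real (card S) > 0" using k cS by simp
  then have "t > 0" using A3 by (cases "t = 0") auto
  have X: "X \<subseteq> Y" "X \<noteq> {}" using y by (auto simp: X_def t_def)
  have finX: "finite X" using X Y finite_subset by blast
  show ?thesis
  proof (rule that[OF X])
    fix B B' :: "real set" assume B: "finite B" "finite B'" "B' \<noteq> {}"
    have cB': "real (card B') > 0" using B by (auto simp: card_gt_0_iff)
    have "third_moment (rep_diff X B) * real t ^ 3
        \<le> 1536 * harm (card X) * (real (card B0) * real (card S) * real (card B))\<^sup>2"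
      by (rule third_moment_rep_diff_le) (use finB0 finS finX B S0 X Y in \<open>auto simp: X_def F_def\<close>)
    also have "\<dots> \<le> 1536 * H * (real (card B0) * real (card S) * real (card B))\<^sup>2"
      unfolding H_def using card_mono[OF Y(1) X(1)] by (intro mult_right_mono mult_left_mono harm_mono) auto
    finally have A4: "third_moment (rep_diff X B) * real t ^ 3
        \<le> 1536 * H * (real (card B0) * real (card S) * real (card B))\<^sup>2" .
    have A1: "third_moment (rep_ratio Y B') * (real (card B0))\<^sup>2
        \<le> 2 * third_moment (rep_ratio Y B0) * (real (card B'))\<^sup>2"
      using max[of B'] B cB0 cB' by (simp add: D_def field_simps)
    show "third_moment (rep_diff X B) * third_moment (rep_ratio Y B')
        \<le> 9216 * harm (card Y) ^ 5 * real (card X) ^ 3 * (real (card B))\<^sup>2 * (real (card B'))\<^sup>2"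
      unfolding H_def[symmetric]
      by (rule energy_product_arith[OF A1 k(2)[folded S_def] A3 A4])
        (use \<open>t > 0\<close> cS cB0 in \<open>auto simp: H_def harm_nonneg third_moment_nonneg\<close>)
  qed
qed

section \<open>Iterated extraction\<close>

text \<open>Peel off subsets of the uncovered part \<open>A - X\<close> one after the other; the multiplicative
  energies of the uncovered parts decrease, so all the peeled subsets satisfy their bounds with the
  last uncovered part in the role of \<open>Y\<close>.\<close>

lemma ex_cover_energy_product_le:
  fixes A :: "real set"
  assumes A: "finite A" "0 \<notin> A" and "1 \<le> m" "m \<le> card A"
  shows "\<exists>X Y. X \<subseteq> A \<and> Y \<subseteq> A \<and> X \<union> Y = A \<and> m \<le> card X \<and> card A + 1 \<le> card Y + m \<and>
    (\<forall>B B'. finite B \<longrightarrow> finite B' \<longrightarrow> B' \<noteq> {} \<longrightarrow>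
      third_moment (rep_diff X B) * third_moment (rep_ratio Y B')
        \<le> 9216 * harm (card A) ^ 5 * real (card X) ^ 3 * (real (card B))\<^sup>2 * (real (card B'))\<^sup>2)"
  using assms(3,4)
proof (induction m rule: dec_induct)
  case base
  then have "A \<noteq> {}" by auto
  then obtain X where X: "X \<subseteq> A" "X \<noteq> {}"
    "\<And>B B'. finite B \<Longrightarrow> finite B' \<Longrightarrow> B' \<noteq> {} \<Longrightarrow>
      third_moment (rep_diff X B) * third_moment (rep_ratio A B')
        \<le> 9216 * harm (card A) ^ 5 * real (card X) ^ 3 * (real (card B))\<^sup>2 * (real (card B'))\<^sup>2"
    using ex_subset_energy_product_le[OF A(1) _ A(2)] by blast
  have "1 \<le> card X" using X A by (simp add: Suc_le_eq card_gt_0_iff finite_subset)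
  then show ?case using X by (intro exI[of _ X] exI[of _ A]) auto
next
  case (step m)
  define K :: real where "K = 9216 * harm (card A) ^ 5"
  obtain X Y where XY: "X \<subseteq> A" "Y \<subseteq> A" "X \<union> Y = A" "m \<le> card X" "card A + 1 \<le> card Y + m"
    and bound: "\<And>B B'. finite B \<Longrightarrow> finite B' \<Longrightarrow> B' \<noteq> {} \<Longrightarrow>
      third_moment (rep_diff X B) * third_moment (rep_ratio Y B')
        \<le> K * real (card X) ^ 3 * (real (card B))\<^sup>2 * (real (card B'))\<^sup>2"
    using step.IH[OF Suc_leD[OF step.prems], folded K_def] by blast
  have finX: "finite X" and finY: "finite Y" using XY A finite_subset by blast+
  show ?case
  proof (cases "Suc m \<le> card X")
    case True
    then show ?thesis using XY bound unfolding K_def by (intro exI[of _ X] exI[of _ Y]) auto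
  next
    case False
    define Y' where "Y' = A - X"
    \<comment> \<open>As \<open>X\<close> has exactly \<open>m\<close> elements, the uncovered part
      has \<open>card A - m\<close>, just what the invariant demands for
      \<open>Suc m\<close>.\<close>
    have cX: "card X = m" using False XY by simp
    have Y': "finite Y'" "0 \<notin> Y'" "card Y' = card A - m"
      using A XY finX cX by (auto simp: Y'_def card_Diff_subset)
    then have "Y' \<noteq> {}" using step.prems by auto
    obtain X' where X': "X' \<subseteq> Y'" "X' \<noteq> {}"
      and bound': "\<And>B B'. finite B \<Longrightarrow> finite B' \<Longrightarrow> B' \<noteq> {} \<Longrightarrow>
        third_moment (rep_diff X' B) * third_moment (rep_ratio Y' B')
          \<le> 9216 * harm (card Y') ^ 5 * real (card X') ^ 3 * (real (card B))\<^sup>2 * (real (card B'))\<^sup>2"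
      using ex_subset_energy_product_le[OF Y'(1) \<open>Y' \<noteq> {}\<close> Y'(2)] by blast
    have finX': "finite X'" using X' Y' finite_subset by blast
    have cX': "card X' \<ge> 1" using X' finX' by (simp add: Suc_le_eq card_gt_0_iff)
    have cU: "card (X \<union> X') = card X + card X'"
      using finX finX' X' by (intro card_Un_disjoint) (auto simp: Y'_def)
    have "9216 * harm (card Y') ^ 5 \<le> K"
      unfolding K_def by (intro mult_left_mono power_mono harm_mono harm_nonneg) (simp_all add: Y'(3))
    have "third_moment (rep_diff (X \<union> X') B) * third_moment (rep_ratio Y' B')
        \<le> K * real (card (X \<union> X')) ^ 3 * (real (card B))\<^sup>2 * (real (card B'))\<^sup>2"
      if B: "finite B" "finite B'" "B' \<noteq> {}" for B B'
    proof -
      define a b c g where "a = real (card X)" and "b = real (card X')"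
        and "c = (real (card B))\<^sup>2 * (real (card B'))\<^sup>2" and "g = third_moment (rep_ratio Y' B')"
      have ab: "a > 0" "b > 0" using cX cX' step.hyps by (auto simp: a_def b_def)
      have c0: "c \<ge> 0" by (simp add: c_def)
      have g0: "g \<ge> 0" by (simp add: g_def third_moment_nonneg)
      \<comment> \<open>From \<open>X \<union> Y = A\<close> it follows that
        \<open>Y' \<subseteq> Y\<close>, so the earlier bound passes to the smaller set.\<close>
      have "g \<le> third_moment (rep_ratio Y B')"
        unfolding g_def using finY B XY A
        by (intro third_moment_mono finite_rep_ratio_support rep_ratio_mono) (auto simp: Y'_def)
      then have "third_moment (rep_diff X B) * g \<le> third_moment (rep_diff X B) * third_moment (rep_ratio Y B')"
        by (intro mult_left_mono third_moment_nonneg)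
      then have 1: "third_moment (rep_diff X B) * g \<le> K * a ^ 3 * c"
        using bound[OF B] by (simp add: a_def c_def mult.assoc)
      have "third_moment (rep_diff X' B) * g \<le> 9216 * harm (card Y') ^ 5 * (b ^ 3 * c)"
        using bound'[OF B] by (simp add: g_def b_def c_def mult.assoc)
      also have "\<dots> \<le> K * (b ^ 3 * c)"
        using \<open>9216 * harm (card Y') ^ 5 \<le> K\<close> ab c0 by (intro mult_right_mono) auto
      finally have 2: "third_moment (rep_diff X' B) * g \<le> K * b ^ 3 * c" by (simp add: mult.assoc)
      have "third_moment (rep_diff (X \<union> X') B) * g
          \<le> ((a + b)\<^sup>2 * (third_moment (rep_diff X B) / a\<^sup>2 + third_moment (rep_diff X' B) / b\<^sup>2)) * g"
        using ab g0 B finX finX'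
        by (intro mult_right_mono third_moment_add_le finite_rep_diff_support rep_diff_Un_le) auto
      also have "\<dots> = (a + b)\<^sup>2 * (third_moment (rep_diff X B) * g / a\<^sup>2 + third_moment (rep_diff X' B) * g / b\<^sup>2)"
        by (simp add: algebra_simps add_divide_distrib)
      also have "\<dots> \<le> (a + b)\<^sup>2 * (K * a ^ 3 * c / a\<^sup>2 + K * b ^ 3 * c / b\<^sup>2)"
        using 1 2 by (intro mult_left_mono add_mono divide_right_mono) auto
      also have "\<dots> = (a + b)\<^sup>2 * (K * a * c + K * b * c)"
        using ab by (simp add: power2_eq_square power3_eq_cube)
      also have "\<dots> = K * (a + b) ^ 3 * c" by algebra
      finally show ?thesis by (simp add: g_def cU a_def b_def c_def mult.assoc)
    qed
    moreover have "X \<union> X' \<subseteq> A" "Y' \<subseteq> A" "X \<union> X' \<union> Y' = A" "Suc m \<le> card (X \<union> X')"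
        "card A + 1 \<le> card Y' + Suc m"
      using XY X' cX cX' cU Y'(3) step.prems by (auto simp: Y'_def)
    ultimately show ?thesis unfolding K_def by blast
  qed
qed

section \<open>Covers by two halves, with zero allowed\<close>

lemma third_moment_rep_diff_singleton:
  assumes "finite B"
  shows "third_moment (rep_diff {c} B) = real (card B)"
proof -
  have "rep_diff {c} B x = (if c - x \<in> B then 1 else 0)" for x
  proof -
    have "{(a, b). a \<in> {c} \<and> b \<in> B \<and> x = a - b} = (if c - x \<in> B then {(c, c - x)} else {})" by auto
    then show ?thesis unfolding rep_diff_def by simp
  qed
  then have "third_moment (rep_diff {c} B) = (\<Sum>x | c - x \<in> B. 1)"
    unfolding third_moment_def by (intro sum.cong) auto
  moreover have "{x. c - x \<in> B} = (\<lambda>b. c - b) ` B" by (force simp: image_iff)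
  moreover have "card ((\<lambda>b. c - b) ` B) = card B" by (intro card_image) (auto simp: inj_on_def)
  ultimately show ?thesis by simp
qed

text \<open>All singletons have the same third moment, and it is at most that of the nonempty
  \<open>X\<close>. Weights \<open>1\<close> and \<open>1\<close> then give
  \<open>4 * (1 + 1) = 8\<close>.\<close>

lemma third_moment_rep_diff_insert_le:
  assumes "finite X" "X \<noteq> {}" "finite B"
  shows "third_moment (rep_diff (insert c X) B) \<le> 8 * third_moment (rep_diff X B)"
proof -
  obtain x where x: "x \<in> X" using assms by blast
  have "third_moment (rep_diff {x} B) \<le> third_moment (rep_diff X B)"
  proof (intro third_moment_mono finite_rep_diff_support assms)
    fix z
    have "finite {(a, b). a \<in> X \<and> b \<in> B \<and> z = a - b}"
      by (rule finite_subset[of _ "X \<times> B"]) (use assms in auto)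
    then show "rep_diff {x} B z \<le> rep_diff X B z"
      unfolding rep_diff_def by (rule card_mono) (use x in auto)
  qed
  then have "third_moment (rep_diff {c} B) \<le> third_moment (rep_diff X B)"
    using assms by (simp add: third_moment_rep_diff_singleton)
  moreover have "third_moment (rep_diff ({c} \<union> X) B)
      \<le> (1 + 1)\<^sup>2 * (third_moment (rep_diff {c} B) / 1\<^sup>2 + third_moment (rep_diff X B) / 1\<^sup>2)"
    using assms by (intro third_moment_add_le finite_rep_diff_support rep_diff_Un_le) auto
  ultimately show ?thesis by simp
qed

text \<open>The element 0 must stay out of \<open>Y\<close>, since it makes \<open>d_mult\<close>
  infinite. It is removed first and afterwards added to \<open>X\<close>, at the cost of a factor 8
  in \<open>73728 = 8 * 9216\<close>.\<close>

lemma ex_half_cover_energy_product_le: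
  fixes A :: "real set"
  assumes A: "finite A" "A \<noteq> {}" "A \<noteq> {0}"
  obtains X Y where "X \<subseteq> A" "Y \<subseteq> A" "X \<union> Y = A" "card A \<le> 2 * card X" "card A \<le> 2 * card Y" "0 \<notin> Y"
    "\<And>B B'. finite B \<Longrightarrow> finite B' \<Longrightarrow> B' \<noteq> {} \<Longrightarrow>
      third_moment (rep_diff X B) * third_moment (rep_ratio Y B')
        \<le> 73728 * harm (card A) ^ 5 * real (card X) ^ 3 * (real (card B))\<^sup>2 * (real (card B'))\<^sup>2"
proof -
  define n where "n = card A"
  define K :: real where "K = 9216 * harm n ^ 5"
  have K0: "K \<ge> 0" by (simp add: K_def harm_nonneg)
  have n1: "n \<ge> 1" using A by (simp add: n_def Suc_le_eq card_gt_0_iff)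
  show thesis
  proof (cases "0 \<in> A")
    case False
    \<comment> \<open>Half of \<open>n\<close> rounded up suits both sets, as
      \<open>n + 1 - (n + 1) div 2\<close> is still at least \<open>n / 2\<close>.\<close>
    have "1 \<le> (n + 1) div 2" "(n + 1) div 2 \<le> card A" using n1 unfolding n_def by auto
    from ex_cover_energy_product_le[OF A(1) False this, folded n_def, folded K_def]
    obtain X Y where XY: "X \<subseteq> A" "Y \<subseteq> A" "X \<union> Y = A"
        "(n + 1) div 2 \<le> card X" "n + 1 \<le> card Y + (n + 1) div 2"
      and bound: "\<And>B B'. finite B \<Longrightarrow> finite B' \<Longrightarrow> B' \<noteq> {} \<Longrightarrow>
        third_moment (rep_diff X B) * third_moment (rep_ratio Y B')
          \<le> K * real (card X) ^ 3 * (real (card B))\<^sup>2 * (real (card B'))\<^sup>2"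
      by blast
    show thesis
    proof (rule that[OF XY(1-3)])
      show "card A \<le> 2 * card X" "card A \<le> 2 * card Y" "0 \<notin> Y"
        using XY False by (auto simp: n_def)
    next
      fix B B' :: "real set" assume B: "finite B" "finite B'" "B' \<noteq> {}"
      have "K * real (card X) ^ 3 * (real (card B))\<^sup>2 * (real (card B'))\<^sup>2
          \<le> (8 * K) * real (card X) ^ 3 * (real (card B))\<^sup>2 * (real (card B'))\<^sup>2"
        using K0 by (intro mult_right_mono) auto
      from order_trans[OF bound[OF B] this]
      show "third_moment (rep_diff X B) * third_moment (rep_ratio Y B')
        \<le> 73728 * harm (card A) ^ 5 * real (card X) ^ 3 * (real (card B))\<^sup>2 * (real (card B'))\<^sup>2"
        by (simp add: K_def n_def)
    qed
  next
    case True
    define A0 where "A0 = A - {0}"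
    have A0: "finite A0" "0 \<notin> A0" "card A0 = n - 1" "A = insert 0 A0" "A0 \<noteq> {}"
      using A True by (auto simp: A0_def n_def)
    then have "n \<ge> 2" using n1 by (metis Suc_1 card_0_eq diff_is_0_eq' not_less_eq_eq)
    \<comment> \<open>Here half of \<open>n\<close> is rounded down: \<open>X\<close> gains an
      element when 0 is added, and \<open>Y\<close> has at least \<open>n - n div 2\<close>
      elements.\<close>
    then have *: "1 \<le> n div 2" "n div 2 \<le> card A0" unfolding A0(3) by linarith+
    define K' :: real where "K' = 9216 * harm (n - 1) ^ 5"
    from ex_cover_energy_product_le[OF A0(1,2) *, unfolded A0(3), folded K'_def]
    obtain X Y where XY: "X \<subseteq> A0" "Y \<subseteq> A0" "X \<union> Y = A0" "n div 2 \<le> card X"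
        "n - 1 + 1 \<le> card Y + n div 2"
      and bound: "\<And>B B'. finite B \<Longrightarrow> finite B' \<Longrightarrow> B' \<noteq> {} \<Longrightarrow>
        third_moment (rep_diff X B) * third_moment (rep_ratio Y B')
          \<le> K' * real (card X) ^ 3 * (real (card B))\<^sup>2 * (real (card B'))\<^sup>2"
      by blast
    have finX: "finite X" using finite_subset[OF XY(1) A0(1)] .
    have cX: "card (insert 0 X) = card X + 1" using XY(1) A0(2) finX by (subst card_insert_disjoint) auto
    have X0: "X \<noteq> {}" using XY(4) \<open>1 \<le> n div 2\<close> by auto
    have KA0: "K' \<le> K"
      unfolding K_def K'_def by (intro mult_left_mono power_mono harm_mono harm_nonneg) simp_all
    have K'0: "K' \<ge> 0" by (simp add: K'_def harm_nonneg)
    show thesis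
    proof (rule that[of "insert 0 X" Y])
      show "insert 0 X \<subseteq> A" "Y \<subseteq> A" "insert 0 X \<union> Y = A" "0 \<notin> Y" using XY A0 by auto
      show "card A \<le> 2 * card (insert 0 X)" using XY(4) cX unfolding n_def by linarith
      show "card A \<le> 2 * card Y" using XY(5) n1 unfolding n_def by linarith
    next
      fix B B' :: "real set" assume B: "finite B" "finite B'" "B' \<noteq> {}"
      have "third_moment (rep_diff (insert 0 X) B) * third_moment (rep_ratio Y B')
          \<le> (8 * third_moment (rep_diff X B)) * third_moment (rep_ratio Y B')"
        using finX X0 B by (intro mult_right_mono third_moment_rep_diff_insert_le third_moment_nonneg) auto
      also have "\<dots> \<le> 8 * (K' * real (card X) ^ 3 * (real (card B))\<^sup>2 * (real (card B'))\<^sup>2)"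
        using bound[OF B] by simp
      also have "\<dots> \<le> 8 * (K * real (card (insert 0 X)) ^ 3 * (real (card B))\<^sup>2 * (real (card B'))\<^sup>2)"
        using KA0 K0 K'0 cX by (intro mult_left_mono mult_right_mono mult_mono power_mono) auto
      finally show "third_moment (rep_diff (insert 0 X) B) * third_moment (rep_ratio Y B')
        \<le> 73728 * harm (card A) ^ 5 * real (card (insert 0 X)) ^ 3 * (real (card B))\<^sup>2 * (real (card B'))\<^sup>2"
        by (simp add: K_def n_def)
    qed
  qed
qed

section \<open>From third moments to \<open>d_add\<close> and \<open>d_mult\<close>\<close>

text \<open>The difference of \<open>harm n\<close> and \<open>ln n\<close> is decreasing, hence at
  most 1. The maximum with 2 keeps the logarithm at least \<open>2 / 3\<close>, which absorbs this 1
  even for \<open>n = 1\<close>.\<close>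

lemma harm_le_ln:
  assumes "n \<ge> 1"
  shows "harm n \<le> 3 * ln (real (max 2 n))"
proof -
  have "harm n - ln (real n) \<le> harm 1 - ln (real 1)"
    using euler_mascheroni_sequence_decreasing[of 1 n] assms by simp
  then have "harm n \<le> 1 + ln (real n)" by (simp add: harm_expand)
  moreover have "ln (real n) \<le> ln (real (max 2 n))" using assms by (subst ln_le_cancel_iff) auto
  moreover have "2 / 3 \<le> ln (real (max 2 n))"
    using ln2_ge_two_thirds by (rule order_trans) (subst ln_le_cancel_iff; simp)
  ultimately show ?thesis by linarith
qed

text \<open>Both suprema can be pulled out of the product in the extended nonnegative reals, so a
  bound uniform in the pairs \<open>B\<close>, \<open>B'\<close> suffices. All energies involved are
  finite, as \<open>Y\<close> avoids 0.\<close>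

lemma d_add_mult_d_mult_le:
  assumes fin: "finite X" "finite Y" and ne: "X \<noteq> {}" "Y \<noteq> {}" and "0 \<notin> Y"
    and bound: "\<And>B B'. finite B \<Longrightarrow> finite B' \<Longrightarrow> B' \<noteq> {} \<Longrightarrow>
      third_moment (rep_diff X B) * third_moment (rep_ratio Y B') \<le> M * (real (card B))\<^sup>2 * (real (card B'))\<^sup>2"
  shows "d_add X * d_mult Y \<le> ennreal (M / (real (card X) * real (card Y)))"
  unfolding d_add_def d_mult_def SUP_mult_left_ennreal SUP_mult_right_ennreal
proof (intro SUP_least, clarsimp)
  fix B B' :: "real set" assume B: "finite B" "B \<noteq> {}" "finite B'" "B' \<noteq> {}"
  have pos: "real (card X) > 0" "real (card Y) > 0" "real (card B) > 0" "real (card B') > 0"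
    using fin ne B by (simp_all add: card_gt_0_iff)
  have "energy3_add X B / (of_nat (card X) * (of_nat (card B))\<^sup>2)
      = ennreal (third_moment (rep_diff X B) / (real (card X) * (real (card B))\<^sup>2))"
    using pos infsum_cube_eq_third_moment[OF finite_rep_diff_support[OF fin(1) B(1)]]
    by (simp add: energy3_add_def divide_ennreal third_moment_nonneg ennreal_of_nat_eq_real_of_nat
        ennreal_power flip: ennreal_mult)
  moreover have "energy3_mult Y B' / (of_nat (card Y) * (of_nat (card B'))\<^sup>2)
      = ennreal (third_moment (rep_ratio Y B') / (real (card Y) * (real (card B'))\<^sup>2))"
    using pos infsum_cube_eq_third_moment[OF finite_rep_ratio_support[OF fin(2) B(3) \<open>0 \<notin> Y\<close>]]
    by (simp add: energy3_mult_def divide_ennreal third_moment_nonneg ennreal_of_nat_eq_real_of_nat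
        ennreal_power flip: ennreal_mult)
  moreover have "third_moment (rep_diff X B) / (real (card X) * (real (card B))\<^sup>2)
      * (third_moment (rep_ratio Y B') / (real (card Y) * (real (card B'))\<^sup>2))
      \<le> M / (real (card X) * real (card Y))"
    using bound[OF B(1,3,4)] pos by (simp add: field_simps)
  ultimately show "energy3_add X B / (of_nat (card X) * (of_nat (card B))\<^sup>2)
      * (energy3_mult Y B' / (of_nat (card Y) * (of_nat (card B'))\<^sup>2))
      \<le> ennreal (M / (real (card X) * real (card Y)))"
    by (simp add: third_moment_nonneg ennreal_leI flip: ennreal_mult)
qed

text \<open>For \<open>A = {0}\<close> both halves would have to be \<open>{0}\<close>, where
  \<open>d_mult\<close> is infinite and \<open>d_add\<close> equals 1, so this set has to be
  excluded.\<close>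

theorem theorem1p10:
  "\<exists>C>0. \<exists>c>0. \<forall>A :: real set. finite A \<and> A \<noteq> {} \<and> A \<noteq> {0} \<longrightarrow>
     (\<exists>X Y. X \<subseteq> A \<and> Y \<subseteq> A \<and> X \<union> Y = A \<and>
        real (card X) \<ge> real (card A) / 2 \<and>
        real (card Y) \<ge> real (card A) / 2 \<and>
        d_add X * d_mult Y \<le> ennreal (log_bound C c (card A) (real (card A))))"
proof (rule exI[of _ 35831808], intro conjI, simp, rule exI[of _ 5], intro conjI allI impI, simp)
  fix A :: "real set" assume A: "finite A \<and> A \<noteq> {} \<and> A \<noteq> {0}"
  then obtain X Y where XY: "X \<subseteq> A" "Y \<subseteq> A" "X \<union> Y = A" "card A \<le> 2 * card X" "card A \<le> 2 * card Y" "0 \<notin> Y"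
    and bound: "\<And>B B'. finite B \<Longrightarrow> finite B' \<Longrightarrow> B' \<noteq> {} \<Longrightarrow>
      third_moment (rep_diff X B) * third_moment (rep_ratio Y B')
        \<le> 73728 * harm (card A) ^ 5 * real (card X) ^ 3 * (real (card B))\<^sup>2 * (real (card B'))\<^sup>2"
    using ex_half_cover_energy_product_le[of A] by blast
  define n x y where "n = real (card A)" and "x = real (card X)" and "y = real (card Y)"
  define L where "L = ln (real (max 2 (card A)))"
  have n1: "card A \<ge> 1" using A by (simp add: Suc_le_eq card_gt_0_iff)
  have half: "n / 2 \<le> x" "n / 2 \<le> y" using XY(4,5) by (simp_all add: n_def x_def y_def)
  have pos: "n > 0" "x > 0" "y > 0" using n1 half by (auto simp: n_def)
  have "x \<le> n" using card_mono[OF _ XY(1)] A by (simp add: x_def n_def)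
  have L: "harm (card A) \<le> 3 * L" "L > 0" unfolding L_def using harm_le_ln[OF n1] by simp_all
  have "finite X" "finite Y" "X \<noteq> {}" "Y \<noteq> {}"
    using A XY finite_subset pos by (auto simp: x_def y_def)
  then have "d_add X * d_mult Y \<le> ennreal (73728 * harm (card A) ^ 5 * x ^ 3 / (x * y))"
    unfolding x_def y_def using XY(6) bound by (rule d_add_mult_d_mult_le)
  \<comment> \<open>The constant is \<open>73728 * 3 ^ 5 * 2\<close>: \<open>3 ^ 5\<close> comes
    from bounding \<open>harm\<close> by \<open>3 * L\<close>, and 2 from
    \<open>x\<^sup>2 / y \<le> 2 * n\<close>.\<close>
  also have "\<dots> \<le> ennreal (35831808 * n * L ^ 5)"
  proof (rule ennreal_leI)
    have "x ^ 3 / (x * y) = x\<^sup>2 / y" using pos by (simp add: power2_eq_square power3_eq_cube)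
    also have "\<dots> \<le> n\<^sup>2 / (n / 2)" using pos half \<open>x \<le> n\<close> by (intro frac_le power_mono) auto
    also have "\<dots> = 2 * n" using pos by (simp add: power2_eq_square)
    finally have "x ^ 3 / (x * y) \<le> 2 * n" .
    moreover have "harm (card A) ^ 5 \<le> (3 * L) ^ 5" using L by (intro power_mono harm_nonneg)
    ultimately have "harm (card A) ^ 5 * (x ^ 3 / (x * y)) \<le> (3 * L) ^ 5 * (2 * n)"
      using L pos by (intro mult_mono) auto
    then have "73728 * (harm (card A) ^ 5 * (x ^ 3 / (x * y))) \<le> 73728 * ((3 * L) ^ 5 * (2 * n))"
      by (rule mult_left_mono) simp
    moreover have "73728 * ((3 * L) ^ 5 * (2 * n)) = 35831808 * n * L ^ 5"
      by (simp add: power_mult_distrib)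
    moreover have "73728 * harm (card A) ^ 5 * x ^ 3 / (x * y) = 73728 * (harm (card A) ^ 5 * (x ^ 3 / (x * y)))"
      by simp
    ultimately show "73728 * harm (card A) ^ 5 * x ^ 3 / (x * y) \<le> 35831808 * n * L ^ 5" by linarith
  qed
  also have "35831808 * n * L ^ 5 = log_bound 35831808 5 (card A) (real (card A))"
    using powr_realpow[OF \<open>L > 0\<close>, of 5] by (simp add: log_bound_def L_def n_def)
  finally have "d_add X * d_mult Y \<le> ennreal (log_bound 35831808 5 (card A) (real (card A)))" .
  then show "\<exists>X Y. X \<subseteq> A \<and> Y \<subseteq> A \<and> X \<union> Y = A \<and> real (card X) \<ge> real (card A) / 2 \<and>
      real (card Y) \<ge> real (card A) / 2 \<and>
      d_add X * d_mult Y \<le> ennreal (log_bound 35831808 5 (card A) (real (card A)))"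
    using XY half unfolding n_def x_def y_def by blast
qed

end
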